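(* Let $E$ be a Polish space, let $\nu$ be a probability measure on $E$ and let $s$ be a measurable function on $E$ with values in $(0,1]$ such that $\nu(s)>0$. Suppose furthermore that $$\int_E\frac1{s(x)}\,d\nu(x)<\infty,$$ and let $P(x,\cdot)=s(x)\nu+(1-s(x))\delta_x$ for $x\in E$. Then the stochastic kernel $P$ is irreducible, aperiodic and positively recurrent. Moreover, let $(X_i)_{i\in\mathbb N}$ denote the strictly stationary Markov chain with kernel $P$, and let $(A_k)_{k>0}$ be a sequence of Borel subsets of $E$ such that $\sum_{k>0}\nu(A_k)<\infty$ and $A_{k+1}\subset A_k$ for every $k>0$. Then $\sum_{k>0}\mathbf 1_{A_k}(X_k)<\infty$ almost surely.
   Context: $\delta_x$ is the Dirac mass at $x$ and $\nu(s)=\int s\,d\nu$. Irreducible, aperiodic and positively recurrent are meant in the standard sense for Markov chains on a general state space; note that $P(x,A)\ge s(x)\nu(A)$ for all $x$ and Borel $A$. In this setting $P$ has a unique invariant probability measure, and "the strictly stationary Markov chain with kernel $P$" is the chain whose initial law is that measure. In the paper's framework, with $Q(x,A)=P(x,A)-s(x)\nu(A)$, positive recurrence is obtained from the condition $\sum_{n\ge0}\nu Q^n(E)<\infty$, the invariant probability measure then being $\bigl(\sum_{n\ge0}\nu Q^n(E)\bigr)^{-1}\sum_{n\ge0}\nu Q^n$. *)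

theory Defs
  imports "HOL-Probability.Probability"
begin

section \<open>Markov kernels on a general state space\<close>

definition stochastic_kernel :: "'a measure \<Rightarrow> ('a \<Rightarrow> 'a measure) \<Rightarrow> bool" where
  "stochastic_kernel S P \<longleftrightarrow> P \<in> S \<rightarrow>\<^sub>M prob_algebra S"

primrec kernel_pow :: "'a measure \<Rightarrow> ('a \<Rightarrow> 'a measure) \<Rightarrow> nat \<Rightarrow> 'a \<Rightarrow> 'a measure" where
  "kernel_pow S P 0 = return S"
| "kernel_pow S P (Suc n) = (\<lambda>x. P x \<bind> kernel_pow S P n)"

definition invariant_prob :: "'a measure \<Rightarrow> ('a \<Rightarrow> 'a measure) \<Rightarrow> 'a measure \<Rightarrow> bool" where
  "invariant_prob S P \<pi> \<longleftrightarrow>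
     prob_space \<pi> \<and> sets \<pi> = sets S \<and>
     (\<forall>A\<in>sets S. emeasure \<pi> A = (\<integral>\<^sup>+ x. emeasure (P x) A \<partial>\<pi>))"

text \<open>
  The following notions are those of Meyn and Tweedie, \<^emph>\<open>Markov Chains and Stochastic Stability\<close>.
\<close>

definition irreducibility_measure ::
    "'a measure \<Rightarrow> ('a \<Rightarrow> 'a measure) \<Rightarrow> 'a measure \<Rightarrow> bool" where
  "irreducibility_measure S P \<phi> \<longleftrightarrow>
     sets \<phi> = sets S \<and> sigma_finite_measure \<phi> \<and> emeasure \<phi> (space S) > 0 \<and>
     (\<forall>x\<in>space S. \<forall>A\<in>sets S. emeasure \<phi> A > 0 \<longrightarrow>
        (\<exists>n\<ge>1. emeasure (kernel_pow S P n x) A > 0))"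

definition irreducible_kernel :: "'a measure \<Rightarrow> ('a \<Rightarrow> 'a measure) \<Rightarrow> bool" where
  "irreducible_kernel S P \<longleftrightarrow>
     stochastic_kernel S P \<and> (\<exists>\<phi>. irreducibility_measure S P \<phi>)"

text \<open>
  Every irreducible kernel has a maximal irreducibility measure, and any two of them have the
  same null sets; hence it is immaterial which one is used in the definitions below.
\<close>

definition maximal_irreducibility_measure ::
    "'a measure \<Rightarrow> ('a \<Rightarrow> 'a measure) \<Rightarrow> 'a measure \<Rightarrow> bool" where
  "maximal_irreducibility_measure S P \<psi> \<longleftrightarrow>
     irreducibility_measure S P \<psi> \<and>
     (\<forall>\<phi>. irreducibility_measure S P \<phi> \<longrightarrow> absolutely_continuous \<psi> \<phi>)"

definition kernel_cycle ::
    "'a measure \<Rightarrow> ('a \<Rightarrow> 'a measure) \<Rightarrow> 'a measure \<Rightarrow> nat \<Rightarrow> (nat \<Rightarrow> 'a set) \<Rightarrow> bool" where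
  "kernel_cycle S P \<psi> d D \<longleftrightarrow>
     d \<ge> 1 \<and> (\<forall>i<d. D i \<in> sets S) \<and> disjoint_family_on D {..<d} \<and>
     (\<forall>i<d. \<forall>x\<in>D i. emeasure (P x) (D (Suc i mod d)) = 1) \<and>
     emeasure \<psi> (space S - (\<Union>i<d. D i)) = 0"

text \<open>The period is the largest length of a cycle, so aperiodic means that no cycle has length \<open>\<ge> 2\<close>.\<close>

definition aperiodic_kernel :: "'a measure \<Rightarrow> ('a \<Rightarrow> 'a measure) \<Rightarrow> bool" where
  "aperiodic_kernel S P \<longleftrightarrow>
     stochastic_kernel S P \<and>
     (\<exists>\<psi>. maximal_irreducibility_measure S P \<psi> \<and>
        (\<forall>d D. kernel_cycle S P \<psi> d D \<longrightarrow> d = 1))"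

definition recurrent_kernel :: "'a measure \<Rightarrow> ('a \<Rightarrow> 'a measure) \<Rightarrow> bool" where
  "recurrent_kernel S P \<longleftrightarrow>
     stochastic_kernel S P \<and>
     (\<exists>\<psi>. maximal_irreducibility_measure S P \<psi> \<and>
        (\<forall>A\<in>sets S. emeasure \<psi> A > 0 \<longrightarrow>
           (\<forall>x\<in>space S. (\<Sum>n. emeasure (kernel_pow S P (Suc n) x) A) = \<infinity>)))"

definition positively_recurrent_kernel :: "'a measure \<Rightarrow> ('a \<Rightarrow> 'a measure) \<Rightarrow> bool" where
  "positively_recurrent_kernel S P \<longleftrightarrow>
     recurrent_kernel S P \<and> (\<exists>\<pi>. invariant_prob S P \<pi>)"


section \<open>Markov chains\<close>

definition past_algebra :: "'w measure \<Rightarrow> 'a measure \<Rightarrow> (nat \<Rightarrow> 'w \<Rightarrow> 'a) \<Rightarrow> nat \<Rightarrow> 'w measure" where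
  "past_algebra M S X n = sigma (space M) {X i -` B \<inter> space M |i B. i \<le> n \<and> B \<in> sets S}"

definition markov_chain ::
    "'w measure \<Rightarrow> 'a measure \<Rightarrow> ('a \<Rightarrow> 'a measure) \<Rightarrow> (nat \<Rightarrow> 'w \<Rightarrow> 'a) \<Rightarrow> bool" where
  "markov_chain M S P X \<longleftrightarrow>
     prob_space M \<and> (\<forall>n. X n \<in> M \<rightarrow>\<^sub>M S) \<and>
     (\<forall>n. \<forall>A\<in>sets S. AE \<omega> in M.
        nn_cond_exp M (past_algebra M S X n) (\<lambda>\<omega>. indicator A (X (Suc n) \<omega>)) \<omega>
          = emeasure (P (X n \<omega>)) A)"

definition stationary_markov_chain ::
    "'w measure \<Rightarrow> 'a measure \<Rightarrow> ('a \<Rightarrow> 'a measure) \<Rightarrow> (nat \<Rightarrow> 'w \<Rightarrow> 'a) \<Rightarrow> bool" where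
  "stationary_markov_chain M S P X \<longleftrightarrow>
     markov_chain M S P X \<and> invariant_prob S P (distr M S (X 0))"


section \<open>The kernel \<open>s(x) \<nu> + (1 - s(x)) \<delta>\<^sub>x\<close>\<close>

definition mix_kernel :: "('a \<Rightarrow> real) \<Rightarrow> 'a measure \<Rightarrow> 'a \<Rightarrow> 'a measure" where
  "mix_kernel s \<nu> x = measure_of (space \<nu>) (sets \<nu>)
     (\<lambda>A. ennreal (s x) * emeasure \<nu> A + ennreal (1 - s x) * emeasure (return \<nu> x) A)"

lemma sets_mix_kernel [simp]: "sets (mix_kernel s \<nu> x) = sets \<nu>"
  by (simp add: mix_kernel_def)

lemma emeasure_mix_kernel:
  assumes "A \<in> sets \<nu>"
  shows "emeasure (mix_kernel s \<nu> x) A =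
           ennreal (s x) * emeasure \<nu> A + ennreal (1 - s x) * indicator A x"
proof -
  let ?f = "\<lambda>A. ennreal (s x) * emeasure \<nu> A + ennreal (1 - s x) * emeasure (return \<nu> x) A"
  have "countably_additive (sets \<nu>) ?f"
  proof (rule countably_additiveI)
    fix B :: "nat \<Rightarrow> 'a set"
    assume B: "range B \<subseteq> sets \<nu>" "disjoint_family B" "\<Union> (range B) \<in> sets \<nu>"
    have "(\<Sum>i. ?f (B i)) = ennreal (s x) * (\<Sum>i. emeasure \<nu> (B i))
            + ennreal (1 - s x) * (\<Sum>i. emeasure (return \<nu> x) (B i))"
      by (simp add: suminf_add[symmetric])
    also have "\<dots> = ?f (\<Union> (range B))"
      using B by (simp add: suminf_emeasure suminf_indicator)
    finally show "(\<Sum>i. ?f (B i)) = ?f (\<Union> (range B))" .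
  qed
  moreover have "positive (sets \<nu>) ?f"
    by (simp add: positive_def)
  ultimately have "emeasure (mix_kernel s \<nu> x) A = ?f A"
    using assms unfolding mix_kernel_def
    by (intro emeasure_measure_of_sigma) (auto simp: sets.sigma_algebra_axioms)
  then show ?thesis using assms by simp
qed

end

theory Submission
  imports Defs
begin

text \<open>
  The measure \<open>\<nu>\<close> is a maximal irreducibility measure, because a point outside a \<open>\<nu>\<close>-null set never
  enters it. In a cycle of length \<open>\<ge> 2\<close> every step is forced to be a jump, so two disjoint members of
  the cycle would both have \<open>\<nu>\<close>-measure 1. The normalisation of \<open>\<nu> / s\<close> is invariant, and every
  invariant probability is absolutely continuous with respect to \<open>\<nu>\<close>.

  For the Borel--Cantelli statement, the chain can only enter \<open>A\<^sub>k\<^sub>+\<^sub>1\<close> at time \<open>k + 1\<close> from outside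
  by a jump, which has probability at most \<open>\<nu>(A\<^sub>k\<^sub>+\<^sub>1)\<close>; these are summable, so almost surely there
  are finitely many entries. Since the sets decrease, the chain then is either eventually always
  outside \<open>A\<^sub>k\<close> or eventually always inside. The second event is null, as its probability is
  bounded by \<open>\<pi>(A\<^sub>k)\<close>, which tends to 0 by absolute continuity.
\<close>

section \<open>Markov chains: transition probabilities and stationary laws\<close>

lemma subalgebra_past_algebra:
  assumes "\<And>n. X n \<in> M \<rightarrow>\<^sub>M S"
  shows "subalgebra M (past_algebra M S X n)"
proof -
  have "{X i -` B \<inter> space M |i B. i \<le> n \<and> B \<in> sets S} \<subseteq> sets M"
    using measurable_sets[OF assms] by auto
  then show ?thesis
    unfolding subalgebra_def past_algebra_def
    by (auto simp: space_measure_of_conv sets_measure_of_conv intro: sets.sigma_sets_subset[THEN subsetD])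
qed

lemma past_algebra_measurable:
  assumes X: "\<And>n. X n \<in> M \<rightarrow>\<^sub>M S" and "i \<le> n"
  shows "X i \<in> past_algebra M S X n \<rightarrow>\<^sub>M S"
proof (rule measurableI)
  fix B assume "B \<in> sets S"
  then show "X i -` B \<inter> space (past_algebra M S X n) \<in> sets (past_algebra M S X n)"
    using \<open>i \<le> n\<close> unfolding past_algebra_def
    by (subst sets_measure_of) (auto simp: space_measure_of_conv)
qed (use measurable_space[OF X] in \<open>auto simp: past_algebra_def space_measure_of_conv\<close>)

text \<open>Integrate the conditional law of \<open>X (Suc n)\<close> against the indicator of an
  event of the past. This is the form in which the Markov property is used below.\<close>

lemma markov_chain_transition:
  assumes mc: "markov_chain M S P X" and P: "P \<in> S \<rightarrow>\<^sub>M prob_algebra S"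
    and A: "A \<in> sets S" and B: "B \<in> sets S"
  shows "emeasure M {\<omega> \<in> space M. X n \<omega> \<in> B \<and> X (Suc n) \<omega> \<in> A} =
    (\<integral>\<^sup>+ \<omega>. indicator B (X n \<omega>) * emeasure (P (X n \<omega>)) A \<partial>M)"
proof -
  let ?F = "past_algebra M S X n"
  interpret M: prob_space M using mc by (simp add: markov_chain_def)
  have X [measurable]: "X n \<in> M \<rightarrow>\<^sub>M S" for n using mc by (simp add: markov_chain_def)
  interpret finite_measure_subalgebra M ?F
    using subalgebra_past_algebra[OF X] by unfold_locales
  have [measurable]: "X n \<in> ?F \<rightarrow>\<^sub>M S" by (rule past_algebra_measurable[OF X]) simp
  note [measurable] = A B
  have "emeasure M {\<omega> \<in> space M. X n \<omega> \<in> B \<and> X (Suc n) \<omega> \<in> A}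
      = (\<integral>\<^sup>+ \<omega>. indicator {\<omega> \<in> space M. X n \<omega> \<in> B \<and> X (Suc n) \<omega> \<in> A} \<omega> \<partial>M)"
    by (rule nn_integral_indicator[symmetric]) measurable
  also have "\<dots> = (\<integral>\<^sup>+ \<omega>. indicator B (X n \<omega>) * indicator A (X (Suc n) \<omega>) \<partial>M)"
    by (intro nn_integral_cong) (auto simp: indicator_def)
  also have "\<dots> = (\<integral>\<^sup>+ \<omega>. indicator B (X n \<omega>)
      * nn_cond_exp M ?F (\<lambda>\<omega>. indicator A (X (Suc n) \<omega>)) \<omega> \<partial>M)"
    by (rule nn_cond_exp_intg[symmetric]) measurable
  also have "\<dots> = (\<integral>\<^sup>+ \<omega>. indicator B (X n \<omega>) * emeasure (P (X n \<omega>)) A \<partial>M)"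
  proof (rule nn_integral_cong_AE)
    have "AE \<omega> in M. nn_cond_exp M ?F (\<lambda>\<omega>. indicator A (X (Suc n) \<omega>)) \<omega> = emeasure (P (X n \<omega>)) A"
      using mc A by (simp add: markov_chain_def)
    then show "AE \<omega> in M. indicator B (X n \<omega>) * nn_cond_exp M ?F (\<lambda>\<omega>. indicator A (X (Suc n) \<omega>)) \<omega>
        = indicator B (X n \<omega>) * emeasure (P (X n \<omega>)) A"
      by eventually_elim simp
  qed
  finally show ?thesis .
qed

text \<open>By induction: the transition formula with \<open>B = space S\<close> pushes the law of
  \<open>X n\<close> through the kernel, and invariance returns the law of
  \<open>X 0\<close>.\<close>

lemma distr_stationary:
  assumes P: "P \<in> S \<rightarrow>\<^sub>M prob_algebra S" and chain: "stationary_markov_chain M S P X"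
  shows "distr M S (X n) = distr M S (X 0)"
proof (induction n)
  case (Suc n)
  have mc: "markov_chain M S P X" and inv: "invariant_prob S P (distr M S (X 0))"
    using chain by (auto simp: stationary_markov_chain_def)
  have X [measurable]: "X n \<in> M \<rightarrow>\<^sub>M S" for n using mc by (simp add: markov_chain_def)
  show ?case
  proof (rule measure_eqI)
    fix A assume "A \<in> sets (distr M S (X (Suc n)))"
    then have A [measurable]: "A \<in> sets S" by simp
    have [measurable]: "(\<lambda>x. emeasure (P x) A) \<in> borel_measurable S"
      using P by (intro measurable_emeasure_kernel[OF _ A] measurable_prob_algebraD)
    have "emeasure (distr M S (X (Suc n))) A
        = emeasure M {\<omega> \<in> space M. X n \<omega> \<in> space S \<and> X (Suc n) \<omega> \<in> A}"
      using measurable_space[OF X[of n]]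
      by (auto simp: emeasure_distr intro!: arg_cong[of _ _ "emeasure M"])
    also have "\<dots> = (\<integral>\<^sup>+ \<omega>. indicator (space S) (X n \<omega>) * emeasure (P (X n \<omega>)) A \<partial>M)"
      by (intro markov_chain_transition[OF mc P]) auto
    also have "\<dots> = (\<integral>\<^sup>+ \<omega>. emeasure (P (X n \<omega>)) A \<partial>M)"
      using measurable_space[OF X[of n]] by (intro nn_integral_cong) auto
    also have "\<dots> = (\<integral>\<^sup>+ x. emeasure (P x) A \<partial>distr M S (X n))"
      by (subst nn_integral_distr) auto
    also have "\<dots> = emeasure (distr M S (X 0)) A"
      unfolding Suc.IH using inv A by (simp add: invariant_prob_def)
    finally show "emeasure (distr M S (X (Suc n))) A = emeasure (distr M S (X 0)) A" .
  qed simp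
qed simp

section \<open>The mixture kernel, its integrals and its powers\<close>

locale mix_kernel_space = prob_space \<nu> for \<nu> :: "'a measure" +
  fixes S :: "'a measure" and s :: "'a \<Rightarrow> real"
  assumes sets_\<nu> [measurable_cong]: "sets \<nu> = sets S"
    and s_measurable [measurable]: "s \<in> borel_measurable S"
    and s_pos: "0 < s x"
    and s_le_1: "s x \<le> 1"
begin

abbreviation P :: "'a \<Rightarrow> 'a measure" where "P \<equiv> mix_kernel s \<nu>"

lemma space_\<nu>: "space \<nu> = space S"
  by (rule sets_eq_imp_space_eq[OF sets_\<nu>])

lemma space_S: "\<nu> (space S) = 1"
  using emeasure_space_1 by (simp add: space_\<nu>)

lemma s_ge_0: "0 \<le> s x"
  using s_pos[of x] by simp

lemma ennreal_s_compl: "ennreal (s x) + ennreal (1 - s x) = 1"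
  using s_ge_0[of x] s_le_1[of x] by (simp flip: ennreal_plus)

lemma emeasure_P:
  "A \<in> sets S \<Longrightarrow> emeasure (P x) A = ennreal (s x) * emeasure \<nu> A + ennreal (1 - s x) * indicator A x"
  by (rule emeasure_mix_kernel) (simp add: sets_\<nu>)

lemma space_P: "space (P x) = space S"
  by (rule sets_eq_imp_space_eq) (simp add: sets_\<nu>)

lemma prob_space_P:
  assumes "x \<in> space S"
  shows "prob_space (P x)"
proof
  show "emeasure (P x) (space (P x)) = 1"
    using assms by (simp add: emeasure_P space_P space_S ennreal_s_compl)
qed

lemma P_measurable: "P \<in> S \<rightarrow>\<^sub>M prob_algebra S"
proof (rule measurable_prob_algebraI)
  show "P \<in> S \<rightarrow>\<^sub>M subprob_algebra S"
  proof (rule measurable_subprob_algebra)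
    fix A assume [measurable]: "A \<in> sets S"
    then show "(\<lambda>x. emeasure (P x) A) \<in> borel_measurable S" by (simp add: emeasure_P)
  qed (simp_all add: prob_space_P prob_space_imp_subprob_space sets_\<nu>)
qed (rule prob_space_P)

lemma P_measurable_subprob [measurable]: "P \<in> S \<rightarrow>\<^sub>M subprob_algebra S"
  using P_measurable by (rule measurable_prob_algebraD)

text \<open>For indicators this is \<open>emeasure_P\<close>; both sides are additive, homogeneous
  and continuous along increasing sequences.\<close>

lemma nn_integral_P:
  assumes x: "x \<in> space S" and f: "f \<in> borel_measurable S"
  shows "(\<integral>\<^sup>+ y. f y \<partial>P x) = ennreal (s x) * (\<integral>\<^sup>+ y. f y \<partial>\<nu>) + ennreal (1 - s x) * f x"
  using f
proof (induction rule: borel_measurable_induct)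
  case (cong f g)
  have "(\<integral>\<^sup>+ y. f y \<partial>P x) = (\<integral>\<^sup>+ y. g y \<partial>P x)" "(\<integral>\<^sup>+ y. f y \<partial>\<nu>) = (\<integral>\<^sup>+ y. g y \<partial>\<nu>)"
    using cong.hyps by (auto intro!: nn_integral_cong simp: space_P space_\<nu>)
  then show ?case using cong x by simp
next
  case (set A)
  then show ?case by (simp add: emeasure_P sets_\<nu>)
next
  case (mult u c)
  then have "u \<in> borel_measurable \<nu>" "u \<in> borel_measurable (P x)"
    by (simp_all add: sets_\<nu> cong: measurable_cong_sets)
  then show ?case using mult by (simp add: nn_integral_cmult algebra_simps)
next
  case (add u v)
  then have "u \<in> borel_measurable \<nu>" "u \<in> borel_measurable (P x)"
    "v \<in> borel_measurable \<nu>" "v \<in> borel_measurable (P x)"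
    by (simp_all add: sets_\<nu> cong: measurable_cong_sets)
  then show ?case using add by (simp add: nn_integral_add algebra_simps)
next
  case (seq U)
  then have [measurable]: "U i \<in> borel_measurable \<nu>" "U i \<in> borel_measurable (P x)" for i
    by (simp_all add: sets_\<nu> cong: measurable_cong_sets)
  have inc: "incseq (\<lambda>i. \<integral>\<^sup>+ y. U i y \<partial>\<nu>)" "incseq (\<lambda>i. U i x)"
    using seq.hyps by (auto simp: incseq_def le_fun_def intro!: nn_integral_mono)
  have "(\<integral>\<^sup>+ y. (SUP i. U i y) \<partial>P x) = (SUP i. \<integral>\<^sup>+ y. U i y \<partial>P x)"
    using seq.hyps by (intro nn_integral_monotone_convergence_SUP) auto
  also have "\<dots> = (SUP i. ennreal (s x) * (\<integral>\<^sup>+ y. U i y \<partial>\<nu>) + ennreal (1 - s x) * U i x)"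
    using seq.IH by simp
  \<comment> \<open>Both terms increase in \<open>i\<close>, so the supremum of the sum
    splits.\<close>
  also have "\<dots> = ennreal (s x) * (SUP i. \<integral>\<^sup>+ y. U i y \<partial>\<nu>) + ennreal (1 - s x) * (SUP i. U i x)"
    using inc by (subst ennreal_SUP_add)
      (auto simp: incseq_def SUP_mult_left_ennreal intro!: mult_left_mono)
  also have "(SUP i. \<integral>\<^sup>+ y. U i y \<partial>\<nu>) = (\<integral>\<^sup>+ y. (SUP i. U i y) \<partial>\<nu>)"
    using seq.hyps by (intro nn_integral_monotone_convergence_SUP[symmetric]) auto
  finally show ?case by (simp add: image_comp)
qed

lemma kernel_pow_measurable: "kernel_pow S P n \<in> S \<rightarrow>\<^sub>M prob_algebra S"
proof (induction n)
  case (Suc n)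
  then show ?case
    by (simp add: measurable_bind_prob_space[OF P_measurable Suc])
qed (simp add: measurable_return_prob_space)

lemma kernel_pow_measurable_subprob [measurable]: "kernel_pow S P n \<in> S \<rightarrow>\<^sub>M subprob_algebra S"
  using kernel_pow_measurable by (rule measurable_prob_algebraD)

lemma emeasure_kernel_pow_measurable [measurable]:
  "A \<in> sets S \<Longrightarrow> (\<lambda>x. emeasure (kernel_pow S P n x) A) \<in> borel_measurable S"
  by (rule measurable_emeasure_kernel[OF kernel_pow_measurable_subprob])

text \<open>First-step analysis: the first move is a draw from \<open>\<nu>\<close> with weight
  \<open>s x\<close> and a stay at \<open>x\<close> otherwise.\<close>

lemma emeasure_kernel_pow_Suc:
  assumes x: "x \<in> space S" and A: "A \<in> sets S"
  shows "emeasure (kernel_pow S P (Suc n) x) A =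
    ennreal (s x) * (\<integral>\<^sup>+ y. emeasure (kernel_pow S P n y) A \<partial>\<nu>)
      + ennreal (1 - s x) * emeasure (kernel_pow S P n x) A"
proof -
  have "space (P x) \<noteq> {}" using x by (auto simp: space_P)
  moreover have "kernel_pow S P n \<in> P x \<rightarrow>\<^sub>M subprob_algebra S"
    by (simp add: sets_\<nu> cong: measurable_cong_sets)
  ultimately have "emeasure (kernel_pow S P (Suc n) x) A
      = (\<integral>\<^sup>+ y. emeasure (kernel_pow S P n y) A \<partial>P x)"
    using A by (simp add: emeasure_bind)
  then show ?thesis
    using A by (simp add: nn_integral_P[OF x])
qed

lemma emeasure_kernel_pow_1:
  assumes "x \<in> space S" "A \<in> sets S"
  shows "emeasure (kernel_pow S P (Suc 0) x) A = emeasure (P x) A"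
  using assms unfolding emeasure_kernel_pow_Suc[OF assms]
  by (simp add: emeasure_P nn_integral_indicator sets_\<nu>)

text \<open>From a point outside a null set, a step either stays put or draws from
  \<open>\<nu>\<close>, which almost surely misses the set. The induction keeps \<open>x\<close>
  arbitrary because its hypothesis is applied at almost every drawn point.\<close>

lemma emeasure_kernel_pow_null:
  assumes A: "A \<in> sets S" "emeasure \<nu> A = 0" and x: "x \<in> space S" "x \<notin> A"
  shows "emeasure (kernel_pow S P n x) A = 0"
  using x
proof (induction n arbitrary: x)
  case (Suc n)
  have "AE y in \<nu>. y \<notin> A"
    using A by (intro AE_not_in) (auto simp: null_sets_def sets_\<nu>)
  then have "AE y in \<nu>. emeasure (kernel_pow S P n y) A = 0"
    by (rule AE_mp) (auto intro!: AE_I2 Suc.IH simp: space_\<nu>)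
  then have "(\<integral>\<^sup>+ y. emeasure (kernel_pow S P n y) A \<partial>\<nu>) = 0"
    using A by (subst nn_integral_0_iff_AE) auto
  then show ?case
    using Suc A by (simp add: emeasure_kernel_pow_Suc del: kernel_pow.simps)
qed (use A in simp)

section \<open>Irreducibility, aperiodicity and recurrence\<close>

lemma irreducibility_measure_\<nu>: "irreducibility_measure S P \<nu>"
  unfolding irreducibility_measure_def
proof (intro conjI ballI impI)
  fix x A assume x: "x \<in> space S" and A: "A \<in> sets S" "0 < emeasure \<nu> A"
  \<comment> \<open>One step suffices: the jump alone gives \<open>A\<close> the mass
    \<open>s x * \<nu> A\<close>.\<close>
  have "0 < emeasure (kernel_pow S P (Suc 0) x) A"
    unfolding emeasure_kernel_pow_1[OF x A(1)] using A s_pos[of x]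
    by (simp add: emeasure_P ennreal_zero_less_mult_iff add_pos_nonneg)
  then show "\<exists>n\<ge>1. 0 < emeasure (kernel_pow S P n x) A" by (intro exI[of _ "Suc 0"]) auto
qed (simp_all add: sets_\<nu> sigma_finite_measure_axioms space_S)

text \<open>A \<open>\<nu>\<close>-null \<open>A\<close> misses some \<open>x\<close>, because
  \<open>\<nu>\<close> has mass one; from this \<open>x\<close> the set is never reached, so no
  irreducibility measure can charge it.\<close>

lemma maximal_irreducibility_measure_\<nu>: "maximal_irreducibility_measure S P \<nu>"
  unfolding maximal_irreducibility_measure_def absolutely_continuous_def
proof (intro conjI allI impI subsetI)
  fix \<phi> A assume \<phi>: "irreducibility_measure S P \<phi>" and "A \<in> null_sets \<nu>"
  then have A: "A \<in> sets S" "emeasure \<nu> A = 0" by (auto simp: null_sets_def sets_\<nu>)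
  have "A \<noteq> space S" using A(2) space_S by auto
  then obtain x where x: "x \<in> space S" "x \<notin> A" using A(1) sets.sets_into_space by blast
  have "emeasure \<phi> A = 0"
    using \<phi> A(1) x(1) emeasure_kernel_pow_null[OF A x]
    unfolding irreducibility_measure_def by (metis less_irrefl not_gr_zero)
  then show "A \<in> null_sets \<phi>"
    using A \<phi> by (auto simp: null_sets_def irreducibility_measure_def)
qed (rule irreducibility_measure_\<nu>)

text \<open>Off \<open>A\<close> the holding term vanishes, so \<open>s x * \<nu> A = 1\<close>, and
  \<open>s x \<le> 1\<close> leaves no room for \<open>\<nu> A < 1\<close>.\<close>

lemma P_eq_1_outside:
  assumes "A \<in> sets S" "x \<notin> A" "emeasure (P x) A = 1"
  shows "emeasure \<nu> A = 1"
proof -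
  have "1 = ennreal (s x) * emeasure \<nu> A" using assms by (simp add: emeasure_P)
  also have "\<dots> \<le> 1 * emeasure \<nu> A" by (intro mult_right_mono) (auto simp: s_le_1)
  finally show ?thesis using emeasure_space_1 emeasure_space[of \<nu> A] by (simp add: antisym)
qed

lemma kernel_cycle_trivial:
  assumes "kernel_cycle S P \<nu> d D"
  shows "d = 1"
proof (rule ccontr)
  assume "d \<noteq> 1"
  with assms have d: "d \<ge> 2"
    and D: "\<And>i. i < d \<Longrightarrow> D i \<in> sets S" "disjoint_family_on D {..<d}"
      "\<And>i x. i < d \<Longrightarrow> x \<in> D i \<Longrightarrow> emeasure (P x) (D (Suc i mod d)) = 1"
      "emeasure \<nu> (space S - (\<Union>i<d. D i)) = 0"
    by (auto simp: kernel_cycle_def)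
  define \<sigma> where "\<sigma> i = Suc i mod d" for i
  have \<sigma>: "\<sigma> i < d" for i using d by (simp add: \<sigma>_def)
  have disj: "D i \<inter> D (\<sigma> i) = {}" if "i < d" for i
  proof -
    \<comment> \<open>This needs \<open>d \<ge> 2\<close>: at the wrap-around
      \<open>Suc i = d\<close> the successor is \<open>0\<close>, which differs from
      \<open>d - 1\<close>.\<close>
    have "\<sigma> i \<noteq> i" using that d by (cases "Suc i = d") (auto simp: \<sigma>_def)
    then show ?thesis using that D(2) \<sigma> by (auto simp: disjoint_family_on_def)
  qed
  have step: "emeasure \<nu> (D (\<sigma> i)) = 1" if "i < d" "D i \<noteq> {}" for i
  proof -
    obtain x where "x \<in> D i" using \<open>D i \<noteq> {}\<close> by auto
    then show ?thesis
      using P_eq_1_outside[OF D(1)[OF \<sigma>[of i]], of x] disj that(1) D(3) by (auto simp: \<sigma>_def)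
  qed
  have "(\<Union>i<d. D i) \<noteq> {}"
  proof
    assume "(\<Union>i<d. D i) = {}"
    then show False using D(4) space_S by (metis Diff_empty zero_neq_one)
  qed
  then obtain i where i: "i < d" "D i \<noteq> {}" by auto
  \<comment> \<open>Moving on by one gives a member of measure one, hence nonempty, so
    \<open>step\<close> applies again and yields two consecutive, disjoint members of measure
    one.\<close>
  define j where "j = \<sigma> i"
  have j: "j < d" "emeasure \<nu> (D j) = 1" using \<sigma> step[OF i] by (auto simp: j_def)
  have k: "emeasure \<nu> (D (\<sigma> j)) = 1" using j by (intro step) auto
  have "emeasure \<nu> (D j \<union> D (\<sigma> j)) = emeasure \<nu> (D j) + emeasure \<nu> (D (\<sigma> j))"
    using j \<sigma> D(1) disj by (intro plus_emeasure[symmetric]) (auto simp: sets_\<nu>)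
  then have "emeasure \<nu> (D j \<union> D (\<sigma> j)) = 2" using j k by simp
  moreover have "emeasure \<nu> (D j \<union> D (\<sigma> j)) \<le> 1" by (rule emeasure_le_1)
  ultimately show False by simp
qed

lemma stochastic_kernel_P: "stochastic_kernel S P"
  by (simp add: stochastic_kernel_def P_measurable)

lemma irreducible_kernel_P: "irreducible_kernel S P"
  using stochastic_kernel_P irreducibility_measure_\<nu> by (auto simp: irreducible_kernel_def)

lemma aperiodic_kernel_P: "aperiodic_kernel S P"
  using stochastic_kernel_P maximal_irreducibility_measure_\<nu> kernel_cycle_trivial
  unfolding aperiodic_kernel_def by blast

text \<open>
  The potential \<open>G\<close> of \<open>A\<close> satisfies \<open>G = P(\<cdot>, A) + s \<nu>(G) + (1 - s) G\<close>, hence \<open>G \<ge> \<nu>(A) + \<nu>(G)\<close>;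
  integrating against \<open>\<nu>\<close> forces \<open>\<nu>(G) = \<infinity>\<close>.
\<close>
lemma potential_infinite:
  assumes A: "A \<in> sets S" "0 < emeasure \<nu> A" and x: "x \<in> space S"
  shows "(\<Sum>n. emeasure (kernel_pow S P (Suc n) x) A) = \<infinity>"
proof -
  define G where "G y = (\<Sum>n. emeasure (kernel_pow S P (Suc n) y) A)" for y
  define I where "I = (\<integral>\<^sup>+ y. G y \<partial>\<nu>)"
  have [measurable]: "G \<in> borel_measurable S"
    unfolding G_def
    by (rule borel_measurable_suminf_order) (rule emeasure_kernel_pow_measurable[OF A(1)])
  have I: "I = (\<Sum>n. \<integral>\<^sup>+ y. emeasure (kernel_pow S P (Suc n) y) A \<partial>\<nu>)"
    unfolding I_def G_def using A
    by (intro nn_integral_suminf) (simp add: sets_\<nu> emeasure_kernel_pow_measurable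
        del: kernel_pow.simps cong: measurable_cong_sets)
  \<comment> \<open>Split off the first term and apply first-step analysis to all later
    ones.\<close>
  have rec: "G y = emeasure (P y) A + (ennreal (s y) * I + ennreal (1 - s y) * G y)"
    if y: "y \<in> space S" for y
  proof -
    have "G y = emeasure (kernel_pow S P (Suc 0) y) A
        + (\<Sum>n. emeasure (kernel_pow S P (Suc (Suc n)) y) A)"
      unfolding G_def by (subst suminf_offset[where i=1]) (simp_all del: kernel_pow.simps)
    also have "(\<Sum>n. emeasure (kernel_pow S P (Suc (Suc n)) y) A)
        = ennreal (s y) * I + ennreal (1 - s y) * G y"
      unfolding emeasure_kernel_pow_Suc[OF y A(1), of "Suc _"] I G_def
      by (simp add: suminf_add[symmetric] del: kernel_pow.simps)
    finally show ?thesis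
      by (simp add: emeasure_kernel_pow_1[OF y A(1)] del: kernel_pow.simps)
  qed
  have ge: "emeasure \<nu> A + I \<le> G y" if y: "y \<in> space S" for y
  proof (cases "G y = \<infinity>")
    case False
    \<comment> \<open>Only the jump part \<open>s y * \<nu> A\<close> of \<open>P y A\<close> is
      kept. Finiteness of \<open>G y\<close> then allows cancelling the holding term, and
      \<open>s y > 0\<close> the remaining factor.\<close>
    have "ennreal (s y) * (emeasure \<nu> A + I) + ennreal (1 - s y) * G y \<le> G y"
      by (subst (2) rec[OF y]) (simp add: emeasure_P A distrib_left add_increasing2 add.assoc)
    also have "G y = ennreal (s y) * G y + ennreal (1 - s y) * G y"
      by (simp flip: distrib_right add: ennreal_s_compl)
    finally have "ennreal (s y) * (emeasure \<nu> A + I) \<le> ennreal (s y) * G y"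
      using False by (auto simp: ennreal_mult_eq_top_iff top.not_eq_extremum)
    then show ?thesis using s_pos[of y] by (simp add: ennreal_mult_le_mult_iff)
  qed simp
  have "emeasure \<nu> A + I \<le> I"
  proof -
    have "emeasure \<nu> A + I = (\<integral>\<^sup>+ y. (emeasure \<nu> A + I) \<partial>\<nu>)"
      using emeasure_space_1 by simp
    also have "\<dots> \<le> I" unfolding I_def using ge[unfolded I_def]
      by (intro nn_integral_mono) (simp add: space_\<nu>)
    finally show ?thesis .
  qed
  then have "I = \<infinity>" using A(2) by (cases I; cases "emeasure \<nu> A") (auto simp flip: ennreal_plus)
  then show ?thesis using ge[OF x] by (simp add: G_def top_unique)
qed

lemma recurrent_kernel_P: "recurrent_kernel S P"
  using stochastic_kernel_P maximal_irreducibility_measure_\<nu> potential_infinite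
  unfolding recurrent_kernel_def by blast

section \<open>Invariant probability measures\<close>

text \<open>Each draw from \<open>\<nu>\<close> is held for a geometric time of mean
  \<open>1 / s x\<close>, so the occupation measure \<open>\<mu>\<close> has density
  \<open>1 / s\<close>. It is the sum over \<open>n\<close> of \<open>\<nu> Q^n\<close>, where
  \<open>Q\<close> is the holding part of the kernel.\<close>

lemma invariant_prob_exists:
  assumes "(\<integral>\<^sup>+ x. ennreal (1 / s x) \<partial>\<nu>) < \<infinity>"
  shows "\<exists>\<pi>. invariant_prob S P \<pi>"
proof -
  define c where "c = (\<integral>\<^sup>+ x. ennreal (1 / s x) \<partial>\<nu>)"
  define \<mu> where "\<mu> = density \<nu> (\<lambda>x. ennreal (1 / s x))"
  \<comment> \<open>Keeps the total mass away from \<open>0\<close>, so that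
    \<open>inverse c\<close> normalises \<open>\<mu>\<close>.\<close>
  have "1 \<le> c"
  proof -
    have "1 = (\<integral>\<^sup>+ x. 1 \<partial>\<nu>)" using emeasure_space_1 by simp
    also have "\<dots> \<le> c" unfolding c_def
      by (intro nn_integral_mono) (simp add: s_pos s_le_1)
    finally show ?thesis .
  qed
  then have c: "c \<noteq> 0" "c \<noteq> \<infinity>" using assms by (auto simp: c_def)
  have \<mu>_inv: "(\<integral>\<^sup>+ x. emeasure (P x) A \<partial>\<mu>) = emeasure \<mu> A" if A [measurable]: "A \<in> sets S" for A
  proof -
    \<comment> \<open>Weighted by \<open>1 / s x\<close>, the jump part contributes the constant
      \<open>emeasure \<nu> A\<close>, whatever \<open>x\<close> is.\<close>
    have *: "ennreal (1 / s x) * emeasure (P x) A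
        = emeasure \<nu> A + ennreal (1 / s x - 1) * indicator A x" for x
    proof -
      have "ennreal (1 / s x) * ennreal (s x) = 1" "ennreal (1 / s x) * ennreal (1 - s x) = ennreal (1 / s x - 1)"
        using s_pos[of x] s_le_1[of x] by (simp_all flip: ennreal_mult' add: field_simps)
      then show ?thesis using A by (simp add: emeasure_P distrib_left flip: mult.assoc)
    qed
    have **: "indicator A x + ennreal (1 / s x - 1) * indicator A x = ennreal (1 / s x) * indicator A x" for x
      using s_pos[of x] s_le_1[of x] ennreal_plus[of 1 "1 / s x - 1"]
      by (auto simp: indicator_def)
    have "(\<integral>\<^sup>+ x. emeasure (P x) A \<partial>\<mu>) = (\<integral>\<^sup>+ x. ennreal (1 / s x) * emeasure (P x) A \<partial>\<nu>)"
      unfolding \<mu>_def by (subst nn_integral_density) (auto simp: emeasure_P)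
    also have "\<dots> = emeasure \<nu> A + (\<integral>\<^sup>+ x. ennreal (1 / s x - 1) * indicator A x \<partial>\<nu>)"
      unfolding * by (subst nn_integral_add) (auto simp: emeasure_space_1)
    \<comment> \<open>With \<open>emeasure \<nu> A\<close> written as the integral of the indicator,
      the weights \<open>1\<close> and \<open>1 / s x - 1\<close> add up to the density.\<close>
    also have "\<dots> = (\<integral>\<^sup>+ x. indicator A x + ennreal (1 / s x - 1) * indicator A x \<partial>\<nu>)"
      by (subst nn_integral_add) (auto simp: sets_\<nu>)
    also have "\<dots> = emeasure \<mu> A"
      unfolding ** \<mu>_def by (subst emeasure_density) (auto simp: sets_\<nu>)
    finally show ?thesis .
  qed
  define \<pi> where "\<pi> = scale_measure (inverse c) \<mu>"
  have "invariant_prob S P \<pi>"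
    unfolding invariant_prob_def
  proof (intro conjI ballI)
    have "inverse c * c = 1"
      using c ennreal_divide_self[of c] by (simp add: divide_ennreal_def mult.commute less_top)
    moreover have "emeasure \<mu> (space \<mu>) = c"
      unfolding \<mu>_def c_def by (subst emeasure_density) (auto intro!: nn_integral_cong)
    ultimately show "prob_space \<pi>"
      by (intro prob_spaceI) (simp add: \<pi>_def space_scale_measure)
    show "sets \<pi> = sets S" by (simp add: \<pi>_def \<mu>_def sets_\<nu>)
    fix A assume A: "A \<in> sets S"
    have "(\<integral>\<^sup>+ x. emeasure (P x) A \<partial>\<pi>) = inverse c * (\<integral>\<^sup>+ x. emeasure (P x) A \<partial>\<mu>)"
      unfolding \<pi>_def using A by (intro nn_integral_scale_measure) (simp add: \<mu>_def emeasure_P)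
    then show "emeasure \<pi> A = (\<integral>\<^sup>+ x. emeasure (P x) A \<partial>\<pi>)"
      using \<mu>_inv[OF A] by (simp add: \<pi>_def)
  qed
  then show ?thesis ..
qed

lemma positively_recurrent_kernel_P:
  assumes "(\<integral>\<^sup>+ x. ennreal (1 / s x) \<partial>\<nu>) < \<infinity>"
  shows "positively_recurrent_kernel S P"
  using recurrent_kernel_P invariant_prob_exists[OF assms]
  by (simp add: positively_recurrent_kernel_def)

text \<open>On a \<open>\<nu>\<close>-null set \<open>A\<close> only the holding term survives, so
  \<open>\<pi> A\<close> is the integral of \<open>1 - s\<close> over \<open>A\<close>. Hence
  \<open>s\<close> integrates to \<open>0\<close> over \<open>A\<close>, and \<open>s > 0\<close>
  gives \<open>\<pi> A = 0\<close>.\<close>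

lemma invariant_prob_absolutely_continuous:
  assumes "invariant_prob S P \<pi>"
  shows "absolutely_continuous \<nu> \<pi>"
  unfolding absolutely_continuous_def
proof
  fix A assume "A \<in> null_sets \<nu>"
  then have A [measurable]: "A \<in> sets S" and A0: "emeasure \<nu> A = 0"
    by (auto simp: null_sets_def sets_\<nu>)
  interpret \<pi>: prob_space \<pi> using assms by (simp add: invariant_prob_def)
  have sets_\<pi> [measurable_cong]: "sets \<pi> = sets S"
    and inv: "emeasure \<pi> A = (\<integral>\<^sup>+ x. emeasure (P x) A \<partial>\<pi>)"
    using assms A by (auto simp: invariant_prob_def)
  let ?J = "\<integral>\<^sup>+ x. ennreal (1 - s x) * indicator A x \<partial>\<pi>"
  have J: "emeasure \<pi> A = ?J"
    unfolding inv by (simp add: emeasure_P A A0)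
  have "emeasure \<pi> A = (\<integral>\<^sup>+ x. ennreal (s x) * indicator A x + ennreal (1 - s x) * indicator A x \<partial>\<pi>)"
    by (simp flip: distrib_right add: ennreal_s_compl sets_\<pi> A)
  also have "\<dots> = (\<integral>\<^sup>+ x. ennreal (s x) * indicator A x \<partial>\<pi>) + ?J"
    by (rule nn_integral_add) auto
  finally have "emeasure \<pi> A = (\<integral>\<^sup>+ x. ennreal (s x) * indicator A x \<partial>\<pi>) + emeasure \<pi> A"
    by (simp flip: J)
  then have "(\<integral>\<^sup>+ x. ennreal (s x) * indicator A x \<partial>\<pi>) = 0"
    using \<pi>.emeasure_finite[of A]
    by (metis add.commute add.right_neutral ennreal_add_left_cancel infinity_ennreal_def)
  then have "AE x in \<pi>. ennreal (s x) * indicator A x = 0"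
    by (subst (asm) nn_integral_0_iff_AE) auto
  then have "AE x in \<pi>. x \<notin> A"
    by (rule AE_mp) (auto intro!: AE_I2 simp: indicator_def ennreal_eq_0_iff s_pos[unfolded less_le_not_le] split: if_splits)
  then show "A \<in> null_sets \<pi>"
    by (subst (asm) AE_iff_null_sets[symmetric]) (auto simp: sets_\<pi>)
qed

section \<open>Finitely many visits to the shrinking sets\<close>

text \<open>The offset \<open>m\<close> separates the index of the set from the time of the chain,
  so that sets numbered from \<open>0\<close> can be paired with a chain observed from time
  \<open>m\<close> on.\<close>

lemma AE_finitely_many_visits:
  assumes chain: "stationary_markov_chain M S P X"
    and A: "\<And>k. A k \<in> sets S" "decseq A"
    and sum: "(\<Sum>k. emeasure \<nu> (A k)) < \<infinity>"
  shows "AE \<omega> in M. (\<Sum>k. indicator (A k) (X (k + m) \<omega>) :: ennreal) < \<infinity>"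
proof -
  have mc: "markov_chain M S P X"
    using chain by (simp add: stationary_markov_chain_def)
  interpret M: prob_space M using mc by (simp add: markov_chain_def)
  have X [measurable]: "X n \<in> M \<rightarrow>\<^sub>M S" for n using mc by (simp add: markov_chain_def)
  have [measurable]: "A k \<in> sets S" for k by (rule A(1))
  \<comment> \<open>Entry at time \<open>k + m + 1\<close>. Both conditions refer to the same set
    \<open>A (Suc k)\<close>, so the holding term contributes nothing to the probability.\<close>
  define E where "E k = {\<omega> \<in> space M. X (k + m) \<omega> \<in> space S - A (Suc k) \<and> X (Suc (k + m)) \<omega> \<in> A (Suc k)}" for k
  have E_sets [measurable]: "E k \<in> sets M" for k unfolding E_def by measurable
  have E_le: "emeasure M (E k) \<le> emeasure \<nu> (A (Suc k))" for k
  proof -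
    have "emeasure M (E k) = (\<integral>\<^sup>+ \<omega>. indicator (space S - A (Suc k)) (X (k + m) \<omega>)
        * emeasure (P (X (k + m) \<omega>)) (A (Suc k)) \<partial>M)"
      unfolding E_def by (intro markov_chain_transition[OF mc P_measurable]) auto
    also have "\<dots> \<le> (\<integral>\<^sup>+ \<omega>. emeasure \<nu> (A (Suc k)) \<partial>M)"
    proof (rule nn_integral_mono)
      fix \<omega>
      have "ennreal (s x) * emeasure \<nu> (A (Suc k)) \<le> 1 * emeasure \<nu> (A (Suc k))" for x
        by (intro mult_right_mono) (auto simp: s_le_1)
      then show "indicator (space S - A (Suc k)) (X (k + m) \<omega>)
          * emeasure (P (X (k + m) \<omega>)) (A (Suc k)) \<le> emeasure \<nu> (A (Suc k))"
        by (auto simp: emeasure_P indicator_def)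
    qed
    also have "\<dots> = emeasure \<nu> (A (Suc k))" by (simp add: M.emeasure_space_1)
    finally show ?thesis .
  qed
  have summable: "summable (\<lambda>k. measure \<nu> (A k))"
    using sum by (intro summable_suminf_not_top) (auto simp: emeasure_eq_measure)
  have "AE \<omega> in M. eventually (\<lambda>k. \<omega> \<in> space M - E k) sequentially"
  proof (rule borel_cantelli_AE1)
    have "summable (\<lambda>k. measure \<nu> (A (Suc k)))" using summable by (subst summable_Suc_iff)
    then show "summable (\<lambda>k. measure M (E k))"
      by (rule summable_comparison_test_ev[rotated])
        (use E_le in \<open>simp add: emeasure_eq_measure M.emeasure_eq_measure\<close>)
  qed (auto simp: M.emeasure_finite less_top[symmetric])
  moreover have "AE \<omega> in M. \<forall>K. \<exists>k\<ge>K. X (k + m) \<omega> \<notin> A k"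
  proof (subst AE_all_countable, rule allI)
    fix K
    define \<pi> where "\<pi> = distr M S (X 0)"
    have \<pi>: "invariant_prob S P \<pi>" and law: "distr M S (X n) = \<pi>" for n
      using chain distr_stationary[OF P_measurable chain]
      by (auto simp: \<pi>_def stationary_markov_chain_def)
    interpret \<pi>: prob_space \<pi> using \<pi> by (simp add: invariant_prob_def)
    have A\<pi>: "A k \<in> sets \<pi>" for k by (simp add: \<pi>_def)
    \<comment> \<open>Absolute continuity transfers null sets only, so the decay of
      \<open>emeasure \<nu> (A k)\<close> is first turned into nullity of the intersection;
      continuity from above then gives decay under \<open>\<pi>\<close>.\<close>
    have "(\<lambda>k. emeasure \<nu> (A k)) \<longlonglongrightarrow> emeasure \<nu> (\<Inter>k. A k)"
      using A by (intro Lim_emeasure_decseq) (auto simp: sets_\<nu>)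
    moreover have "(\<lambda>k. emeasure \<nu> (A k)) \<longlonglongrightarrow> 0"
      using summable_LIMSEQ_zero[OF summable] by (simp add: emeasure_eq_measure tendsto_ennrealI[of _ 0, simplified])
    ultimately have "(\<Inter>k. A k) \<in> null_sets \<nu>"
      using LIMSEQ_unique by (intro null_setsI) (auto simp: sets_\<nu>)
    then have null: "emeasure \<pi> (\<Inter>k. A k) = 0"
      using invariant_prob_absolutely_continuous[OF \<pi>] by (auto simp: absolutely_continuous_def)
    have lim: "(\<lambda>k. emeasure \<pi> (A k)) \<longlonglongrightarrow> 0"
      using Lim_emeasure_decseq[of A \<pi>] A(2) A\<pi> null by auto
    let ?N = "{\<omega> \<in> space M. \<forall>k\<ge>K. X (k + m) \<omega> \<in> A k}"
    \<comment> \<open>For \<open>k \<ge> K\<close>, \<open>?N\<close> lies in each event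
      \<open>X (k + m) \<in> A k\<close>, and all these variables have the law
      \<open>\<pi>\<close>.\<close>
    have "emeasure M ?N \<le> emeasure \<pi> (A k)" if "k \<ge> K" for k
    proof -
      have "emeasure M ?N \<le> emeasure M (X (k + m) -` A k \<inter> space M)"
        using that by (intro emeasure_mono) auto
      also have "\<dots> = emeasure \<pi> (A k)"
        unfolding law[of "k + m", symmetric] by (simp add: emeasure_distr)
      finally show ?thesis .
    qed
    then have "emeasure M ?N \<le> 0"
      by (intro tendsto_lowerbound[OF lim]) (auto simp: eventually_sequentially)
    then show "AE \<omega> in M. \<exists>k\<ge>K. X (k + m) \<omega> \<notin> A k"
      by (intro AE_I[of _ _ ?N]) auto
  qed
  ultimately show ?thesis
  proof eventually_elim
    case (elim \<omega>)
    then obtain K where K: "\<And>k. k \<ge> K \<Longrightarrow> \<omega> \<in> space M - E k"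
      by (auto simp: eventually_sequentially)
    \<comment> \<open>An index past the last entry at which the chain is outside.\<close>
    obtain L where L: "L \<ge> K" "X (L + m) \<omega> \<notin> A L" using elim(2) by blast
    have out: "X (k + m) \<omega> \<notin> A k" if "k \<ge> L" for k
      using that
    proof (induction k rule: dec_induct)
      case (step k)
      have "\<omega> \<in> space M" "\<omega> \<notin> E k" using K[of k] step L by auto
      \<comment> \<open>As the sets decrease, being outside \<open>A k\<close> means being outside
        \<open>A (Suc k)\<close>; the absence of an entry carries this to the next time.\<close>
      moreover have "X (k + m) \<omega> \<notin> A (Suc k)" using step decseq_SucD[OF A(2), of k] by auto
      ultimately show ?case using measurable_space[OF X, of \<omega>] by (auto simp: E_def)
    qed (rule L)
    have "(\<Sum>k. indicator (A k) (X (k + m) \<omega>) :: ennreal) = (\<Sum>k<L. indicator (A k) (X (k + m) \<omega>))"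
      using out by (intro suminf_finite) (auto simp: not_less)
    also have "\<dots> < \<infinity>" by (auto split: split_indicator)
    finally show ?case .
  qed
qed

end

theorem theorem5p4:
  fixes \<nu> :: "'a::polish_space measure"
    and s :: "'a \<Rightarrow> real"
    and P :: "'a \<Rightarrow> 'a measure"
  assumes "prob_space \<nu>" and "sets \<nu> = sets borel"
    and "s \<in> borel_measurable borel"
    and "\<And>x. 0 < s x \<and> s x \<le> 1"
    and "(\<integral>x. s x \<partial>\<nu>) > 0"
    and "(\<integral>\<^sup>+ x. ennreal (1 / s x) \<partial>\<nu>) < \<infinity>"
    and "P = mix_kernel s \<nu>"
  shows "stochastic_kernel borel P \<and>
    irreducible_kernel borel P \<and>
    aperiodic_kernel borel P \<and>
    positively_recurrent_kernel borel P \<and>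
    (\<forall>(M :: 'w measure) (X :: nat \<Rightarrow> 'w \<Rightarrow> 'a) (A :: nat \<Rightarrow> 'a set).
      stationary_markov_chain M borel P X \<longrightarrow>
      (\<forall>k>0. A k \<in> sets borel) \<longrightarrow>
      (\<Sum>k. emeasure \<nu> (A (Suc k))) < \<infinity> \<longrightarrow>
      (\<forall>k>0. A (Suc k) \<subseteq> A k) \<longrightarrow>
      (AE \<omega> in M. (\<Sum>k. indicator (A (Suc k)) (X (Suc k) \<omega>) :: ennreal) < \<infinity>))"
proof -
  interpret prob_space \<nu> by fact
  interpret mix_kernel_space \<nu> borel s
    by unfold_locales (use assms in auto)
  \<comment> \<open>Shifting the sets by one and taking \<open>m = 1\<close> pairs
    \<open>A (Suc k)\<close> with \<open>X (Suc k)\<close>; \<open>A 0\<close> and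
    \<open>X 0\<close> stay out of the sum.\<close>
  have "AE \<omega> in M. (\<Sum>k. indicator (A (Suc k)) (X (Suc k) \<omega>) :: ennreal) < \<infinity>"
    if "stationary_markov_chain M borel (mix_kernel s \<nu>) X" "\<forall>k>0. A k \<in> sets borel"
      "(\<Sum>k. emeasure \<nu> (A (Suc k))) < \<infinity>" "\<forall>k>0. A (Suc k) \<subseteq> A k"
    for M :: "'w measure" and X :: "nat \<Rightarrow> 'w \<Rightarrow> 'a" and A :: "nat \<Rightarrow> 'a set"
    using AE_finitely_many_visits[OF that(1), of "\<lambda>k. A (Suc k)" 1] that(2-4)
    by (simp add: decseq_SucI)
  then show ?thesis
    unfolding assms(7)
    by (intro conjI allI impI stochastic_kernel_P irreducible_kernel_P aperiodic_kernel_P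
      positively_recurrent_kernel_P[OF assms(6)])
qed

end
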